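(* Let $K$ be a field and let $f\in K[[x]]=K[[x_1,\dots,x_r]]$ and $g\in K[[y]]=K[[y_1,\dots,y_s]]$ be nonzero elements. 1. If $X$ is a matrix factorization of $f$ and $Y$ is a matrix factorization of $g$, then the refined multiplicative tensor product $X\,\overline{\otimes}\,Y$ is a matrix factorization of the product $fg\in K[[x_1,\dots,x_r,y_1,\dots,y_s]]$, and the size of each matrix factor of $X\,\overline{\otimes}\,Y$ is one half the size of the matrix factors of the multiplicative tensor product $X\,\widetilde{\otimes}\,Y$. 2. The refined multiplicative tensor product $$(-)\,\overline{\otimes}\,(-): MF(K[[x]],f)\times MF(K[[y]],g)\longrightarrow MF(K[[x,y]],fg)$$ (with the action on objects and morphisms given in the context) is a bifunctor.
   Context: Let $R$ be a (formal power series) ring and $f\in R$. An $n\times n$ matrix factorization of $f$ (a matrix factorization of size $n$) is a pair $(\phi,\psi)$ of $n\times n$ matrices over $R$ with $\phi\psi=\psi\phi=fI_n$; $\phi$ and $\psi$ are its matrix factors. The category $MF(R,f)$ has the matrix factorizations of $f$ over $R$ as objects. A morphism $(\phi,\psi)\to(\phi',\psi')$, where the objects have sizes $n$ and $n'$, is a pair $(\alpha,\beta)$ of $n'\times n$ matrices over $R$ with $\alpha\phi=\phi'\beta$ and $\psi'\alpha=\beta\psi$. Composition is componentwise matrix multiplication and the identity of an object of size $n$ is $(I_n,I_n)$. Let $X=(\phi,\psi)$ be a matrix factorization of $f\in K[[x]]$ of size $n$ and $Y=(\sigma,\rho)$ a matrix factorization of $g\in K[[y]]$ of size $m$; view all matrices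 as matrices over $L=K[[x,y]]$, and let $\otimes$ of matrices denote the usual (Kronecker) tensor product. Multiplicative tensor product: $X\,\widetilde{\otimes}\,Y=\left(\begin{bmatrix}\phi\otimes\sigma&0\\0&\phi\otimes\sigma\end{bmatrix},\begin{bmatrix}\psi\otimes\rho&0\\0&\psi\otimes\rho\end{bmatrix}\right)$. Refined multiplicative tensor product: $X\,\overline{\otimes}\,Y=(\phi\otimes\sigma,\ \psi\otimes\rho)$, each component being an endomorphism of $L^n\otimes_L L^m$. On morphisms: for $\zeta_f=(\alpha_f,\beta_f)$ in $MF(K[[x]],f)$ and $\zeta_g=(\alpha_g,\beta_g)$ in $MF(K[[y]],g)$, $\zeta_f\,\overline{\otimes}\,\zeta_g=(\alpha_f\otimes\alpha_g,\ \beta_f\otimes\beta_g)$. *)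

theory Defs
  imports "HOL-Library.Poly_Mapping" "Jordan_Normal_Form.Matrix"
begin

text \<open>A formal power series in the variables \<open>'v\<close> is an arbitrary family of coefficients indexed by
  the monomials, i.e. by the finitely supported exponent vectors \<open>'v \<Rightarrow>\<^sub>0 nat\<close>. For finite \<open>'v\<close>
  with \<open>r\<close> elements this is the ring \<open>K[[x_1, \<dots>, x_r]]\<close>.\<close>

typedef ('v, 'a) mfps = "UNIV :: (('v \<Rightarrow>\<^sub>0 nat) \<Rightarrow> 'a) set"
  morphisms mfps_coeff Abs_mfps by simp

lemma mfps_coeff_Abs [simp]: "mfps_coeff (Abs_mfps c) = c"
  by (simp add: Abs_mfps_inverse)

lemma mfps_eqI: "(\<And>m. mfps_coeff p m = mfps_coeff q m) \<Longrightarrow> p = q"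
  by (metis ext mfps_coeff_inject)

definition splittings :: "('v \<Rightarrow>\<^sub>0 nat) \<Rightarrow> (('v \<Rightarrow>\<^sub>0 nat) \<times> ('v \<Rightarrow>\<^sub>0 nat)) set" where
  "splittings m = {(a, b). a + b = m}"

text \<open>So the sum in the Cauchy product below is never the default \<open>0\<close> of an infinite sum.\<close>

lemma finite_splittings: "finite (splittings m)"
proof -
  let ?L = "Poly_Mapping.lookup" and ?K = "Poly_Mapping.keys m"
  have fin: "finite {a. \<forall>k. ?L a k \<le> ?L m k}" (is "finite ?A")
  proof (rule inj_on_finite)
    let ?F = "\<lambda>a. restrict (?L a) ?K"
    show "inj_on ?F ?A"
    proof (rule inj_onI)
      fix a b assume a: "a \<in> ?A" and b: "b \<in> ?A" and eq: "?F a = ?F b"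
      have "?L a k = ?L b k" for k
      proof (cases "k \<in> ?K")
        case True then show ?thesis using eq by (metis restrict_apply')
      next
        case False
        then have "?L m k = 0" by (simp add: Poly_Mapping.in_keys_iff)
        then show ?thesis using a b by (metis (mono_tags, lifting) le_zero_eq mem_Collect_eq)
      qed
      then show "a = b" by (rule poly_mapping_eqI)
    qed
    show "?F ` ?A \<subseteq> PiE ?K (\<lambda>k. {..?L m k})" by auto
    show "finite (PiE ?K (\<lambda>k. {..?L m k}))" by (intro finite_PiE) auto
  qed
  have "splittings m \<subseteq> (\<lambda>a. (a, m - a)) ` ?A"
    by (auto simp: splittings_def lookup_add image_iff)
  then show ?thesis using fin finite_surj by blast
qed

instantiation mfps :: (type, zero) zero begin
definition zero_mfps where "0 = Abs_mfps (\<lambda>_. 0)"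
instance ..
end

instantiation mfps :: (type, zero_neq_one) zero_neq_one begin
definition one_mfps where "1 = Abs_mfps (\<lambda>m. if m = 0 then 1 else 0)"
instance
proof
  have "mfps_coeff (0 :: ('a, 'b) mfps) 0 \<noteq> mfps_coeff 1 0"
    by (simp add: zero_mfps_def one_mfps_def)
  then show "(0 :: ('a, 'b) mfps) \<noteq> 1" by metis
qed
end

instantiation mfps :: (type, comm_ring_1) comm_ring_1 begin
definition plus_mfps where "p + q = Abs_mfps (\<lambda>m. mfps_coeff p m + mfps_coeff q m)"
definition minus_mfps where "p - q = Abs_mfps (\<lambda>m. mfps_coeff p m - mfps_coeff q m)"
definition uminus_mfps where "- p = Abs_mfps (\<lambda>m. - mfps_coeff p m)"
definition times_mfps where
  "p * q = Abs_mfps (\<lambda>m. \<Sum>(a, b) \<in> splittings m. mfps_coeff p a * mfps_coeff q b)"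
instance
proof
  fix p q r :: "('a, 'b) mfps"
  note lin = plus_mfps_def minus_mfps_def uminus_mfps_def zero_mfps_def
  show "p + q + r = p + (q + r)" "p + q = q + p" "0 + p = p" "- p + p = 0" "p - q = p + - q"
    by (auto intro!: mfps_eqI simp: lin)
  show "(p + q) * r = p * r + q * r"
    by (rule mfps_eqI) (auto simp: lin times_mfps_def distrib_right split_def sum.distrib)
  show "p * q = q * p"
  proof (rule mfps_eqI)
    fix m
    show "mfps_coeff (p * q) m = mfps_coeff (q * p) m"
      unfolding times_mfps_def mfps_coeff_Abs
      by (rule sum.reindex_bij_witness[of _ prod.swap prod.swap])
        (auto simp: splittings_def add.commute mult.commute)
  qed
  show "1 * p = p"
  proof (rule mfps_eqI)
    fix m
    have "mfps_coeff (1 * p) m = (\<Sum>(a, b) \<in> splittings m. (if a = 0 then 1 else 0) * mfps_coeff p b)"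
      by (simp add: times_mfps_def one_mfps_def)
    also have "\<dots> = (\<Sum>(a, b) \<in> {(0 :: 'a \<Rightarrow>\<^sub>0 nat, m)}. (if a = 0 then 1 else 0) * mfps_coeff p b)"
      by (rule sum.mono_neutral_right[OF finite_splittings]) (auto simp: splittings_def split: if_splits)
    finally show "mfps_coeff (1 * p) m = mfps_coeff p m" by simp
  qed
  show "p * q * r = p * (q * r)"
  proof (rule mfps_eqI)
    fix m
    let ?c = mfps_coeff
    have "?c (p * q * r) m =
        (\<Sum>s \<in> splittings m. \<Sum>t \<in> splittings (fst s). ?c p (fst t) * ?c q (snd t) * ?c r (snd s))"
      by (simp add: times_mfps_def split_def sum_distrib_right)
    also have "\<dots> = (\<Sum>(s, t) \<in> Sigma (splittings m) (\<lambda>s. splittings (fst s)).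
        ?c p (fst t) * ?c q (snd t) * ?c r (snd s))"
      by (rule sum.Sigma) (auto simp: finite_splittings)
    also have "\<dots> = (\<Sum>(s, t) \<in> Sigma (splittings m) (\<lambda>s. splittings (snd s)).
        ?c p (fst s) * (?c q (fst t) * ?c r (snd t)))"
      by (rule sum.reindex_bij_witness[of _ "\<lambda>((a, d), (b, c)). ((a + b, c), (a, b))"
            "\<lambda>((d, c), (a, b)). ((a, b + c), (b, c))"])
        (auto simp: splittings_def ac_simps)
    also have "\<dots> =
        (\<Sum>s \<in> splittings m. \<Sum>t \<in> splittings (snd s). ?c p (fst s) * (?c q (fst t) * ?c r (snd t)))"
      by (rule sum.Sigma[symmetric]) (auto simp: finite_splittings)
    also have "\<dots> = ?c (p * (q * r)) m"
      by (simp add: times_mfps_def split_def sum_distrib_left)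
    finally show "?c (p * q * r) m = ?c (p * (q * r)) m" .
  qed
qed
end

text \<open>The inclusion of power series rings induced by an injective map \<open>\<iota>\<close> of variables: a monomial
  in which a variable outside the range of \<open>\<iota>\<close> occurs has coefficient \<open>0\<close>. The variables of
  \<open>K[[x, y]]\<close> are the disjoint union \<open>'r + 's\<close>, and \<open>K[[x]]\<close> and \<open>K[[y]]\<close> are included in it
  via \<open>Inl\<close> and \<open>Inr\<close>.\<close>

definition mfps_incl :: "('v \<Rightarrow> 'w) \<Rightarrow> ('v, 'a::zero) mfps \<Rightarrow> ('w, 'a) mfps" where
  "mfps_incl \<iota> p = Abs_mfps (\<lambda>m. if Poly_Mapping.keys m \<subseteq> range \<iota>
     then mfps_coeff p (Poly_Mapping.map_key \<iota> m) else 0)"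

abbreviation incl_x :: "('r, 'a::zero) mfps \<Rightarrow> ('r + 's, 'a) mfps" where
  "incl_x \<equiv> mfps_incl Inl"

abbreviation incl_y :: "('s, 'a::zero) mfps \<Rightarrow> ('r + 's, 'a) mfps" where
  "incl_y \<equiv> mfps_incl Inr"


record ('o, 'm) cat_data =
  Obj :: "'o set"
  Hom :: "'o \<Rightarrow> 'o \<Rightarrow> 'm set"
  Ident :: "'o \<Rightarrow> 'm"
  Comp :: "'o \<Rightarrow> 'o \<Rightarrow> 'o \<Rightarrow> 'm \<Rightarrow> 'm \<Rightarrow> 'm"

text \<open>\<open>Comp C X Y Z h g\<close> is the composite of \<open>g : X \<rightarrow> Y\<close> followed by \<open>h : Y \<rightarrow> Z\<close>. Hom-sets
  of different pairs of objects need not be disjoint, so operations on morphisms take the objects as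
  arguments.\<close>

locale category =
  fixes C :: "('o, 'm) cat_data"
  assumes Ident_in_Hom: "X \<in> Obj C \<Longrightarrow> Ident C X \<in> Hom C X X"
    and Comp_in_Hom: "\<lbrakk>X \<in> Obj C; Y \<in> Obj C; Z \<in> Obj C; g \<in> Hom C X Y; h \<in> Hom C Y Z\<rbrakk>
      \<Longrightarrow> Comp C X Y Z h g \<in> Hom C X Z"
    and Comp_Ident_left: "\<lbrakk>X \<in> Obj C; Y \<in> Obj C; g \<in> Hom C X Y\<rbrakk>
      \<Longrightarrow> Comp C X Y Y (Ident C Y) g = g"
    and Comp_Ident_right: "\<lbrakk>X \<in> Obj C; Y \<in> Obj C; g \<in> Hom C X Y\<rbrakk>
      \<Longrightarrow> Comp C X X Y g (Ident C X) = g"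
    and Comp_assoc: "\<lbrakk>W \<in> Obj C; X \<in> Obj C; Y \<in> Obj C; Z \<in> Obj C;
        g \<in> Hom C W X; h \<in> Hom C X Y; k \<in> Hom C Y Z\<rbrakk>
      \<Longrightarrow> Comp C W Y Z k (Comp C W X Y h g) = Comp C W X Z (Comp C X Y Z k h) g"

locale cat_functor = source: category C + target: category D
  for C :: "('o, 'm) cat_data" and D :: "('p, 'n) cat_data" +
  fixes Fo :: "'o \<Rightarrow> 'p" and Fm :: "'o \<Rightarrow> 'o \<Rightarrow> 'm \<Rightarrow> 'n"
  assumes Fo_in_Obj: "X \<in> Obj C \<Longrightarrow> Fo X \<in> Obj D"
    and Fm_in_Hom: "\<lbrakk>X \<in> Obj C; Y \<in> Obj C; g \<in> Hom C X Y\<rbrakk> \<Longrightarrow> Fm X Y g \<in> Hom D (Fo X) (Fo Y)"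
    and Fm_Ident: "X \<in> Obj C \<Longrightarrow> Fm X X (Ident C X) = Ident D (Fo X)"
    and Fm_Comp: "\<lbrakk>X \<in> Obj C; Y \<in> Obj C; Z \<in> Obj C; g \<in> Hom C X Y; h \<in> Hom C Y Z\<rbrakk>
      \<Longrightarrow> Fm X Z (Comp C X Y Z h g) = Comp D (Fo X) (Fo Y) (Fo Z) (Fm Y Z h) (Fm X Y g)"

definition prod_cat ::
  "('o, 'm) cat_data \<Rightarrow> ('p, 'n) cat_data \<Rightarrow> ('o \<times> 'p, 'm \<times> 'n) cat_data" where
  "prod_cat C D = \<lparr>
     Obj = Obj C \<times> Obj D,
     Hom = (\<lambda>(X, Y) (X', Y'). Hom C X X' \<times> Hom D Y Y'),
     Ident = (\<lambda>(X, Y). (Ident C X, Ident D Y)),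
     Comp = (\<lambda>(X, Y) (X', Y') (X'', Y'') (h, h') (g, g'). (Comp C X X' X'' h g, Comp D Y Y' Y'' h' g'))\<rparr>"

definition bifunctor ::
  "('o, 'm) cat_data \<Rightarrow> ('p, 'n) cat_data \<Rightarrow> ('q, 'l) cat_data \<Rightarrow>
   ('o \<times> 'p \<Rightarrow> 'q) \<Rightarrow> ('o \<times> 'p \<Rightarrow> 'o \<times> 'p \<Rightarrow> 'm \<times> 'n \<Rightarrow> 'l) \<Rightarrow> bool" where
  "bifunctor C D E Fo Fm \<longleftrightarrow> category C \<and> category D \<and> cat_functor (prod_cat C D) E Fo Fm"


definition is_mf :: "'a::comm_ring_1 \<Rightarrow> nat \<Rightarrow> 'a mat \<times> 'a mat \<Rightarrow> bool" where
  "is_mf f n = (\<lambda>(\<phi>, \<psi>). \<phi> \<in> carrier_mat n n \<and> \<psi> \<in> carrier_mat n n \<and>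
     \<phi> * \<psi> = f \<cdot>\<^sub>m 1\<^sub>m n \<and> \<psi> * \<phi> = f \<cdot>\<^sub>m 1\<^sub>m n)"

definition matrix_factorizations :: "'a::comm_ring_1 \<Rightarrow> ('a mat \<times> 'a mat) set" where
  "matrix_factorizations f = {X. \<exists>n. is_mf f n X}"

definition matrix_factors :: "'a mat \<times> 'a mat \<Rightarrow> 'a mat set" where
  "matrix_factors X = {fst X, snd X}"

text \<open>On objects, \<open>dim_row \<phi>\<close> is the size of \<open>(\<phi>, \<psi>)\<close>.\<close>

definition MF :: "'a::comm_ring_1 \<Rightarrow> ('a mat \<times> 'a mat, 'a mat \<times> 'a mat) cat_data" where
  "MF f = \<lparr>
     Obj = matrix_factorizations f,
     Hom = (\<lambda>(\<phi>, \<psi>) (\<phi>', \<psi>'). {(\<alpha>, \<beta>).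
       \<alpha> \<in> carrier_mat (dim_row \<phi>') (dim_row \<phi>) \<and> \<beta> \<in> carrier_mat (dim_row \<phi>') (dim_row \<phi>) \<and>
       \<alpha> * \<phi> = \<phi>' * \<beta> \<and> \<psi>' * \<alpha> = \<beta> * \<psi>}),
     Ident = (\<lambda>(\<phi>, \<psi>). (1\<^sub>m (dim_row \<phi>), 1\<^sub>m (dim_row \<phi>))),
     Comp = (\<lambda>_ _ _ (\<alpha>', \<beta>') (\<alpha>, \<beta>). (\<alpha>' * \<alpha>, \<beta>' * \<beta>))\<rparr>"


definition kronecker :: "'a::times mat \<Rightarrow> 'a mat \<Rightarrow> 'a mat" where
  "kronecker A B = mat (dim_row A * dim_row B) (dim_col A * dim_col B)
     (\<lambda>(i, j). A $$ (i div dim_row B, j div dim_col B) * B $$ (i mod dim_row B, j mod dim_col B))"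

definition kronecker_xy ::
  "('r, 'k::comm_ring_1) mfps mat \<Rightarrow> ('s, 'k) mfps mat \<Rightarrow> ('r + 's, 'k) mfps mat" where
  "kronecker_xy A B = kronecker (map_mat incl_x A) (map_mat incl_y B)"

definition block_diag2 :: "'a::zero mat \<Rightarrow> 'a mat" where
  "block_diag2 A =
     four_block_mat A (0\<^sub>m (dim_row A) (dim_col A)) (0\<^sub>m (dim_row A) (dim_col A)) A"

definition mult_tensor ::
  "('r, 'k::comm_ring_1) mfps mat \<times> ('r, 'k) mfps mat \<Rightarrow> ('s, 'k) mfps mat \<times> ('s, 'k) mfps mat \<Rightarrow>
   ('r + 's, 'k) mfps mat \<times> ('r + 's, 'k) mfps mat" where
  "mult_tensor = (\<lambda>(\<phi>, \<psi>) (\<sigma>, \<rho>).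
     (block_diag2 (kronecker_xy \<phi> \<sigma>), block_diag2 (kronecker_xy \<psi> \<rho>)))"

definition refined_tensor ::
  "('r, 'k::comm_ring_1) mfps mat \<times> ('r, 'k) mfps mat \<Rightarrow> ('s, 'k) mfps mat \<times> ('s, 'k) mfps mat \<Rightarrow>
   ('r + 's, 'k) mfps mat \<times> ('r + 's, 'k) mfps mat" where
  "refined_tensor = (\<lambda>(\<phi>, \<psi>) (\<sigma>, \<rho>). (kronecker_xy \<phi> \<sigma>, kronecker_xy \<psi> \<rho>))"

definition refined_tensor_mor ::
  "('r, 'k::comm_ring_1) mfps mat \<times> ('r, 'k) mfps mat \<Rightarrow> ('s, 'k) mfps mat \<times> ('s, 'k) mfps mat \<Rightarrow>
   ('r + 's, 'k) mfps mat \<times> ('r + 's, 'k) mfps mat" where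
  "refined_tensor_mor = (\<lambda>(\<alpha>\<^sub>f, \<beta>\<^sub>f) (\<alpha>\<^sub>g, \<beta>\<^sub>g). (kronecker_xy \<alpha>\<^sub>f \<alpha>\<^sub>g, kronecker_xy \<beta>\<^sub>f \<beta>\<^sub>g))"

end

theory Submission
  imports Defs
begin

text \<open>Everything follows from the mixed product property
  \<open>(A \<otimes> B) (C \<otimes> D) = A C \<otimes> B D\<close> of the Kronecker product, once the inclusions of \<open>K[[x]]\<close> and
  \<open>K[[y]]\<close> in \<open>K[[x, y]]\<close> are known to be ring homomorphisms, so that it also holds for
  \<open>kronecker_xy\<close>. For instance, \<open>(\<phi> \<otimes> \<sigma>) (\<psi> \<otimes> \<rho>) = f I \<otimes> g I = f g I\<close>.\<close>

section \<open>Inclusions of power series rings\<close>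

text \<open>Exponents in \<open>nat\<close> cannot cancel, so a sum vanishes at a variable only
  where both summands do. Hence a monomial supported in \<open>range \<iota>\<close> splits only
  into monomials supported there.\<close>

lemma keys_add_nat:
  fixes a b :: "'v \<Rightarrow>\<^sub>0 nat"
  shows "Poly_Mapping.keys (a + b) = Poly_Mapping.keys a \<union> Poly_Mapping.keys b"
  by (auto simp: Poly_Mapping.in_keys_iff lookup_add)

text \<open>For injective \<open>\<iota>\<close>, \<open>map_key \<iota>\<close> is precomposition
  with \<open>\<iota>\<close>, so it determines the exponents on \<open>range \<iota>\<close>; the
  support conditions force the others to be 0.\<close>

lemma map_key_inj_on_keys:
  assumes "inj \<iota>" "Poly_Mapping.keys a \<subseteq> range \<iota>" "Poly_Mapping.keys b \<subseteq> range \<iota>"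
    and "Poly_Mapping.map_key \<iota> a = Poly_Mapping.map_key \<iota> b"
  shows "a = b"
proof (rule poly_mapping_eqI)
  fix w
  show "Poly_Mapping.lookup a w = Poly_Mapping.lookup b w"
  proof (cases "w \<in> range \<iota>")
    case True
    then obtain v where "w = \<iota> v" by blast
    then show ?thesis
      using arg_cong[OF assms(4), of "\<lambda>p. Poly_Mapping.lookup p v"] \<open>inj \<iota>\<close>
      by (simp add: map_key.rep_eq)
  next
    case False
    then have "w \<notin> Poly_Mapping.keys a" "w \<notin> Poly_Mapping.keys b" using assms(2,3) by auto
    then show ?thesis by (simp add: Poly_Mapping.in_keys_iff)
  qed
qed

lemma map_key_surj_on_keys:
  assumes "inj \<iota>"
  obtains a where "Poly_Mapping.keys a \<subseteq> range \<iota>" "Poly_Mapping.map_key \<iota> a = a'"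
proof
  \<comment> \<open>The preimage of \<open>a'\<close> is its extension by zero along
    \<open>\<iota>\<close>.\<close>
  define h where "h w = (if w \<in> range \<iota> then Poly_Mapping.lookup a' (inv_into UNIV \<iota> w) else 0)" for w
  \<comment> \<open>Without finite support, \<open>Abs_poly_mapping h\<close> would be
    unspecified.\<close>
  have "{w. h w \<noteq> 0} \<subseteq> \<iota> ` Poly_Mapping.keys a'"
    using assms by (auto simp: h_def Poly_Mapping.in_keys_iff split: if_splits)
  then have "finite {w. h w \<noteq> 0}" by (rule finite_subset) simp
  then have l: "Poly_Mapping.lookup (Abs_poly_mapping h) = h" by simp
  show "Poly_Mapping.keys (Abs_poly_mapping h) \<subseteq> range \<iota>"
    unfolding keys.rep_eq l by (auto simp: h_def split: if_splits)
  show "Poly_Mapping.map_key \<iota> (Abs_poly_mapping h) = a'"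
    using assms by (auto intro!: poly_mapping_eqI simp: map_key.rep_eq l h_def)
qed

text \<open>This matches the index sets of the Cauchy products before and after the inclusion. Every
  part of a splitting of \<open>m\<close> is supported in \<open>range \<iota>\<close>, where
  \<open>map_key \<iota>\<close> is injective, and extension by zero lifts every splitting
  back.\<close>

lemma bij_betw_splittings_map_key:
  assumes "inj \<iota>" "Poly_Mapping.keys m \<subseteq> range \<iota>"
  shows "bij_betw (\<lambda>(a, b). (Poly_Mapping.map_key \<iota> a, Poly_Mapping.map_key \<iota> b))
    (splittings m) (splittings (Poly_Mapping.map_key \<iota> m))"
  unfolding bij_betw_def
proof
  show "inj_on (\<lambda>(a, b). (Poly_Mapping.map_key \<iota> a, Poly_Mapping.map_key \<iota> b)) (splittings m)"
  proof (rule inj_onI, clarify)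
    fix a b c d
    assume s: "(a, b) \<in> splittings m" "(c, d) \<in> splittings m"
      and eq: "Poly_Mapping.map_key \<iota> a = Poly_Mapping.map_key \<iota> c"
        "Poly_Mapping.map_key \<iota> b = Poly_Mapping.map_key \<iota> d"
    have "Poly_Mapping.keys a \<union> Poly_Mapping.keys b \<subseteq> range \<iota>" "Poly_Mapping.keys c \<union> Poly_Mapping.keys d \<subseteq> range \<iota>"
      using s assms(2) by (auto simp: splittings_def keys_add_nat[symmetric])
    then show "a = c \<and> b = d" using eq by (auto intro: map_key_inj_on_keys[OF assms(1)])
  qed
  show "(\<lambda>(a, b). (Poly_Mapping.map_key \<iota> a, Poly_Mapping.map_key \<iota> b)) ` splittings m =
      splittings (Poly_Mapping.map_key \<iota> m)" (is "?F ` _ = _")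
  proof
    show "?F ` splittings m \<subseteq> splittings (Poly_Mapping.map_key \<iota> m)"
      using assms(1) by (auto simp: splittings_def map_key_plus)
    show "splittings (Poly_Mapping.map_key \<iota> m) \<subseteq> ?F ` splittings m"
    proof
      fix s assume "s \<in> splittings (Poly_Mapping.map_key \<iota> m)"
      then obtain a' b' where s: "s = (a', b')" and ab: "a' + b' = Poly_Mapping.map_key \<iota> m"
        by (auto simp: splittings_def)
      obtain a where a: "Poly_Mapping.keys a \<subseteq> range \<iota>" "Poly_Mapping.map_key \<iota> a = a'"
        using map_key_surj_on_keys[OF assms(1)] .
      obtain b where b: "Poly_Mapping.keys b \<subseteq> range \<iota>" "Poly_Mapping.map_key \<iota> b = b'"
        using map_key_surj_on_keys[OF assms(1)] .
      \<comment> \<open>Both sides are supported in \<open>range \<iota>\<close> and have the same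
        image under \<open>map_key \<iota>\<close>.\<close>
      have "a + b = m"
        using a b ab assms by (intro map_key_inj_on_keys[of \<iota>]) (auto simp: keys_add_nat map_key_plus)
      then have "(a, b) \<in> splittings m" by (simp add: splittings_def)
      then show "s \<in> ?F ` splittings m" using s a b by force
    qed
  qed
qed

lemma mfps_incl_mult:
  fixes p q :: "('v, 'a::comm_ring_1) mfps"
  assumes "inj \<iota>"
  shows "mfps_incl \<iota> (p * q) = mfps_incl \<iota> p * mfps_incl \<iota> q"
proof (rule mfps_eqI)
  fix m
  show "mfps_coeff (mfps_incl \<iota> (p * q)) m = mfps_coeff (mfps_incl \<iota> p * mfps_incl \<iota> q) m"
  proof (cases "Poly_Mapping.keys m \<subseteq> range \<iota>")
    case True
    have "(\<Sum>(a, b) \<in> splittings (Poly_Mapping.map_key \<iota> m). mfps_coeff p a * mfps_coeff q b) =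
        (\<Sum>(a, b) \<in> splittings m.
          mfps_coeff p (Poly_Mapping.map_key \<iota> a) * mfps_coeff q (Poly_Mapping.map_key \<iota> b))"
      by (subst sum.reindex_bij_betw[OF bij_betw_splittings_map_key[OF assms True], symmetric])
        (simp add: split_def)
    \<comment> \<open>Both parts of a splitting of \<open>m\<close> stay inside
      \<open>range \<iota>\<close>, so the default 0 of \<open>mfps_incl\<close> never occurs
      here.\<close>
    also have "\<dots> = (\<Sum>(a, b) \<in> splittings m.
        mfps_coeff (mfps_incl \<iota> p) a * mfps_coeff (mfps_incl \<iota> q) b)"
      using True by (intro sum.cong refl) (auto simp: splittings_def mfps_incl_def keys_add_nat)
    finally show ?thesis using True by (simp add: mfps_incl_def times_mfps_def)
  next
    case False
    \<comment> \<open>A variable of \<open>m\<close> outside \<open>range \<iota>\<close> occurs in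
      \<open>a\<close> or in \<open>b\<close>, so one factor of each summand is 0.\<close>
    then have "(\<Sum>(a, b) \<in> splittings m.
        mfps_coeff (mfps_incl \<iota> p) a * mfps_coeff (mfps_incl \<iota> q) b) = 0"
      by (intro sum.neutral) (auto simp: splittings_def mfps_incl_def keys_add_nat)
    with False show ?thesis by (auto simp: mfps_incl_def times_mfps_def)
  qed
qed

text \<open>Among the monomials supported in \<open>range \<iota>\<close>, only the constant one
  restricts to the constant monomial; all other monomials get coefficient 0 by definition.\<close>

lemma mfps_incl_one:
  fixes \<iota> :: "'v \<Rightarrow> 'w"
  assumes "inj \<iota>"
  shows "mfps_incl \<iota> (1 :: ('v, 'a::comm_ring_1) mfps) = 1"
proof (rule mfps_eqI)
  fix m :: "'w \<Rightarrow>\<^sub>0 nat"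
  have "Poly_Mapping.map_key \<iota> m = 0 \<longleftrightarrow> m = 0" if "Poly_Mapping.keys m \<subseteq> range \<iota>"
    using map_key_inj_on_keys[OF assms that, of 0] assms by auto
  then show "mfps_coeff (mfps_incl \<iota> (1 :: ('v, 'a) mfps)) m = mfps_coeff 1 m"
    by (auto simp: mfps_incl_def one_mfps_def)
qed

text \<open>This makes \<open>mat_hom_mult\<close> available, which moves the inclusions through
  matrix products.\<close>

lemma semiring_hom_mfps_incl:
  assumes "inj \<iota>"
  shows "semiring_hom (mfps_incl \<iota> :: ('v, 'a::comm_ring_1) mfps \<Rightarrow> _)"
proof
  fix p q :: "('v, 'a) mfps"
  show "mfps_incl \<iota> (p + q) = mfps_incl \<iota> p + mfps_incl \<iota> q"
    by (rule mfps_eqI) (simp add: mfps_incl_def plus_mfps_def)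
  show "mfps_incl \<iota> (0 :: ('v, 'a) mfps) = 0"
    by (rule mfps_eqI) (simp add: mfps_incl_def zero_mfps_def)
qed (simp_all add: assms mfps_incl_mult mfps_incl_one)

interpretation incl_x: semiring_hom "incl_x :: ('r, 'a::comm_ring_1) mfps \<Rightarrow> ('r + 's, 'a) mfps"
  by (rule semiring_hom_mfps_incl) simp

interpretation incl_y: semiring_hom "incl_y :: ('s, 'a::comm_ring_1) mfps \<Rightarrow> ('r + 's, 'a) mfps"
  by (rule semiring_hom_mfps_incl) simp

section \<open>The Kronecker product\<close>

lemma kronecker_carrier:
  "A \<in> carrier_mat n k \<Longrightarrow> B \<in> carrier_mat m l \<Longrightarrow> kronecker A B \<in> carrier_mat (n * m) (k * l)"
  by (simp add: kronecker_def)

text \<open>The bound on \<open>i\<close> rules out \<open>m = 0\<close>, where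
  \<open>i mod 0 = i\<close> would break the claim.\<close>

lemma mod_less_of_less_mult: "i mod m < m" if "i < n * m" for i n m :: nat
  using that by (cases "m = 0") auto

text \<open>Division with remainder by \<open>d\<close> identifies the indices below
  \<open>c * d\<close> with pairs, the inverse being \<open>i * d + j\<close>. This is how
  \<open>kronecker\<close> numbers its rows and columns.\<close>

lemma sum_div_mod:
  fixes F :: "nat \<Rightarrow> nat \<Rightarrow> 'a::comm_monoid_add"
  shows "(\<Sum>k<c * d. F (k div d) (k mod d)) = (\<Sum>i<c. \<Sum>j<d. F i j)"
proof -
  have "i * d + j < c * d" if "i < c" "j < d" for i j
  proof -
    have "i * d + j < Suc i * d" using \<open>j < d\<close> by simp
    also have "\<dots> \<le> c * d" using \<open>i < c\<close> by (intro mult_le_mono1) simp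
    finally show ?thesis .
  qed
  then have "(\<Sum>k<c * d. F (k div d) (k mod d)) = (\<Sum>(i, j) \<in> {..<c} \<times> {..<d}. F i j)"
    by (intro sum.reindex_bij_witness[of _ "\<lambda>(i, j). i * d + j" "\<lambda>k. (k div d, k mod d)"])
      (auto simp: less_mult_imp_div_less mod_less_of_less_mult)
  then show ?thesis by (simp add: sum.cartesian_product)
qed

text \<open>The summation index of the product on the right encodes a pair. Summing over the two
  components separately and moving entries of \<open>B\<close> past entries of \<open>C\<close> by
  commutativity makes the double sum a product of two sums, namely an entry of \<open>A * C\<close>
  times an entry of \<open>B * D\<close>.\<close>

lemma kronecker_mult:
  fixes A B C D :: "'a::comm_semiring_0 mat"
  assumes "A \<in> carrier_mat n k" "C \<in> carrier_mat k p" "B \<in> carrier_mat m l" "D \<in> carrier_mat l q"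
  shows "kronecker (A * C) (B * D) = kronecker A B * kronecker C D"
proof (rule eq_matI)
  fix i j assume "i < dim_row (kronecker A B * kronecker C D)"
    "j < dim_col (kronecker A B * kronecker C D)"
  then have i: "i < n * m" and j: "j < p * q" using assms by (auto simp: kronecker_def)
  note bounds = less_mult_imp_div_less[OF i] less_mult_imp_div_less[OF j]
    mod_less_of_less_mult[OF i] mod_less_of_less_mult[OF j]
  have "(kronecker A B * kronecker C D) $$ (i, j) =
      (\<Sum>s<k * l. A $$ (i div m, s div l) * B $$ (i mod m, s mod l) *
        (C $$ (s div l, j div q) * D $$ (s mod l, j mod q)))"
    using assms i j by (simp add: kronecker_def scalar_prod_def atLeast0LessThan)
  also have "\<dots> = (\<Sum>a<k. \<Sum>b<l. A $$ (i div m, a) * B $$ (i mod m, b) *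
        (C $$ (a, j div q) * D $$ (b, j mod q)))"
    by (rule sum_div_mod)
  also have "\<dots> = (\<Sum>a<k. A $$ (i div m, a) * C $$ (a, j div q)) *
        (\<Sum>b<l. B $$ (i mod m, b) * D $$ (b, j mod q))"
    by (simp add: sum_product ac_simps)
  also have "\<dots> = kronecker (A * C) (B * D) $$ (i, j)"
    using assms i j bounds by (simp add: kronecker_def scalar_prod_def atLeast0LessThan)
  finally show "kronecker (A * C) (B * D) $$ (i, j) = (kronecker A B * kronecker C D) $$ (i, j)"
    by simp
qed (use assms in \<open>auto simp: kronecker_def\<close>)

lemma kronecker_smult_one:
  fixes a b :: "'a::comm_semiring_1"
  shows "kronecker (a \<cdot>\<^sub>m 1\<^sub>m n) (b \<cdot>\<^sub>m 1\<^sub>m m) = (a * b) \<cdot>\<^sub>m 1\<^sub>m (n * m)"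
proof (rule eq_matI)
  fix i j assume "i < dim_row ((a * b) \<cdot>\<^sub>m 1\<^sub>m (n * m))" "j < dim_col ((a * b) \<cdot>\<^sub>m 1\<^sub>m (n * m))"
  then have i: "i < n * m" and j: "j < n * m" by auto
  \<comment> \<open>An index is determined by quotient and remainder, so an entry is diagonal
    exactly when it is diagonal in both factors.\<close>
  have "i = j \<longleftrightarrow> i div m = j div m \<and> i mod m = j mod m" by (metis div_mult_mod_eq)
  then show "kronecker (a \<cdot>\<^sub>m 1\<^sub>m n) (b \<cdot>\<^sub>m 1\<^sub>m m) $$ (i, j) = ((a * b) \<cdot>\<^sub>m 1\<^sub>m (n * m)) $$ (i, j)"
    using i j by (auto simp: kronecker_def less_mult_imp_div_less mod_less_of_less_mult)
qed (auto simp: kronecker_def)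

lemma one_smult_mat [simp]: "(1 :: 'a::monoid_mult) \<cdot>\<^sub>m A = A"
  by (rule eq_matI) auto

section \<open>Kronecker products of matrices over K[[x]] and K[[y]]\<close>

lemma kronecker_xy_carrier:
  "A \<in> carrier_mat n k \<Longrightarrow> B \<in> carrier_mat m l \<Longrightarrow> kronecker_xy A B \<in> carrier_mat (n * m) (k * l)"
  unfolding kronecker_xy_def by (rule kronecker_carrier) auto

lemma dim_kronecker_xy:
  "dim_row (kronecker_xy A B) = dim_row A * dim_row B"
  "dim_col (kronecker_xy A B) = dim_col A * dim_col B"
  by (simp_all add: kronecker_xy_def kronecker_def)

lemma kronecker_xy_mult:
  assumes "A \<in> carrier_mat n k" "C \<in> carrier_mat k p" "B \<in> carrier_mat m l" "D \<in> carrier_mat l q"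
  shows "kronecker_xy (A * C) (B * D) = kronecker_xy A B * kronecker_xy C D"
  unfolding kronecker_xy_def incl_x.mat_hom_mult[OF assms(1,2)] incl_y.mat_hom_mult[OF assms(3,4)]
  using assms by (intro kronecker_mult) auto

lemma kronecker_xy_smult_one:
  fixes f :: "('r, 'k::comm_ring_1) mfps" and g :: "('s, 'k) mfps"
  shows "kronecker_xy (f \<cdot>\<^sub>m 1\<^sub>m n) (g \<cdot>\<^sub>m 1\<^sub>m m) = (incl_x f * incl_y g) \<cdot>\<^sub>m 1\<^sub>m (n * m)"
proof -
  have "map_mat incl_x (f \<cdot>\<^sub>m 1\<^sub>m n) = (incl_x f :: ('r + 's, 'k) mfps) \<cdot>\<^sub>m 1\<^sub>m n"
    and "map_mat incl_y (g \<cdot>\<^sub>m 1\<^sub>m m) = (incl_y g :: ('r + 's, 'k) mfps) \<cdot>\<^sub>m 1\<^sub>m m"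
    by (auto intro!: eq_matI)
  then show ?thesis unfolding kronecker_xy_def by (simp only: kronecker_smult_one)
qed

lemma kronecker_xy_one: "kronecker_xy (1\<^sub>m n) (1\<^sub>m m) = 1\<^sub>m (n * m)"
  using kronecker_xy_smult_one[of 1 n 1 m] by simp

section \<open>Matrix factorizations\<close>

lemma matrix_factorizationsE:
  assumes "X \<in> matrix_factorizations f"
  obtains n \<phi> \<psi> where "X = (\<phi>, \<psi>)" "\<phi> \<in> carrier_mat n n" "\<psi> \<in> carrier_mat n n"
    "\<phi> * \<psi> = f \<cdot>\<^sub>m 1\<^sub>m n" "\<psi> * \<phi> = f \<cdot>\<^sub>m 1\<^sub>m n"
  using assms by (auto simp: matrix_factorizations_def is_mf_def)

lemma MF_Hom_iff:
  assumes "\<phi> \<in> carrier_mat n n" "\<phi>' \<in> carrier_mat n' n'"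
  shows "(\<alpha>, \<beta>) \<in> Hom (MF f) (\<phi>, \<psi>) (\<phi>', \<psi>') \<longleftrightarrow>
    \<alpha> \<in> carrier_mat n' n \<and> \<beta> \<in> carrier_mat n' n \<and> \<alpha> * \<phi> = \<phi>' * \<beta> \<and> \<psi>' * \<alpha> = \<beta> * \<psi>"
  using assms by (simp add: MF_def)

text \<open>The unit, associativity and interchange laws are matrix identities that depend only on
  the shapes of the components; this rule extracts just these shapes.\<close>

lemma MF_HomE:
  assumes "\<zeta> \<in> Hom (MF f) X Y"
  obtains \<alpha> \<beta> where "\<zeta> = (\<alpha>, \<beta>)"
    "\<alpha> \<in> carrier_mat (dim_row (fst Y)) (dim_row (fst X))"
    "\<beta> \<in> carrier_mat (dim_row (fst Y)) (dim_row (fst X))"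
  using assms by (cases X; cases Y) (auto simp: MF_def)

lemma MF_simps [simp]:
  "Obj (MF f) = matrix_factorizations f"
  "Ident (MF f) (\<phi>, \<psi>) = (1\<^sub>m (dim_row \<phi>), 1\<^sub>m (dim_row \<phi>))"
  "Comp (MF f) X Y Z (\<alpha>', \<beta>') (\<alpha>, \<beta>) = (\<alpha>' * \<alpha>, \<beta>' * \<beta>)"
  by (simp_all add: MF_def)

lemma category_MF: "category (MF f)"
proof
  fix X assume "X \<in> Obj (MF f)"
  then have "X \<in> matrix_factorizations f" by simp
  then show "Ident (MF f) X \<in> Hom (MF f) X X"
    by (elim matrix_factorizationsE) (auto simp: MF_def)
next
  fix X Y Z g h
  assume "X \<in> Obj (MF f)" "Y \<in> Obj (MF f)" "Z \<in> Obj (MF f)"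
    and g: "g \<in> Hom (MF f) X Y" and h: "h \<in> Hom (MF f) Y Z"
  then have "X \<in> matrix_factorizations f" "Y \<in> matrix_factorizations f" "Z \<in> matrix_factorizations f"
    by simp_all
  then obtain n \<phi> \<psi> n' \<phi>' \<psi>' n'' \<phi>'' \<psi>''
    where X: "X = (\<phi>, \<psi>)" "\<phi> \<in> carrier_mat n n" "\<psi> \<in> carrier_mat n n"
      and Y: "Y = (\<phi>', \<psi>')" "\<phi>' \<in> carrier_mat n' n'" "\<psi>' \<in> carrier_mat n' n'"
      and Z: "Z = (\<phi>'', \<psi>'')" "\<phi>'' \<in> carrier_mat n'' n''" "\<psi>'' \<in> carrier_mat n'' n''"
    by (elim matrix_factorizationsE)
  obtain \<alpha> \<beta> \<alpha>' \<beta>' where gh: "g = (\<alpha>, \<beta>)" "h = (\<alpha>', \<beta>')" by (metis surj_pair)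
  have c: "\<alpha> \<in> carrier_mat n' n" "\<beta> \<in> carrier_mat n' n"
      "\<alpha>' \<in> carrier_mat n'' n'" "\<beta>' \<in> carrier_mat n'' n'"
    and e: "\<alpha> * \<phi> = \<phi>' * \<beta>" "\<psi>' * \<alpha> = \<beta> * \<psi>" "\<alpha>' * \<phi>' = \<phi>'' * \<beta>'" "\<psi>'' * \<alpha>' = \<beta>' * \<psi>'"
    using g h X Y Z unfolding gh by (simp_all add: MF_Hom_iff)
  \<comment> \<open>The composite satisfies the morphism equations by pasting commuting squares:
    first the square of \<open>g\<close>, then that of \<open>h\<close>.\<close>
  have "\<alpha>' * \<alpha> * \<phi> = \<alpha>' * (\<alpha> * \<phi>)" using c X(2) by simp
  also have "\<dots> = \<alpha>' * \<phi>' * \<beta>" using c Y(2) e(1) by simp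
  also have "\<dots> = \<phi>'' * (\<beta>' * \<beta>)" using c Z(2) e(3) by simp
  finally have 1: "\<alpha>' * \<alpha> * \<phi> = \<phi>'' * (\<beta>' * \<beta>)" .
  \<comment> \<open>For the second equation the square of \<open>h\<close> comes first.\<close>
  have "\<psi>'' * (\<alpha>' * \<alpha>) = \<psi>'' * \<alpha>' * \<alpha>" using c Z(3) by simp
  also have "\<dots> = \<beta>' * (\<psi>' * \<alpha>)" using c Y(3) e(4) by simp
  also have "\<dots> = \<beta>' * \<beta> * \<psi>" using c X(3) e(2) by simp
  finally have 2: "\<psi>'' * (\<alpha>' * \<alpha>) = \<beta>' * \<beta> * \<psi>" .
  show "Comp (MF f) X Y Z h g \<in> Hom (MF f) X Z"
    unfolding gh X(1) Z(1) MF_simps MF_Hom_iff[OF X(2) Z(2)] using 1 2 c by auto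
next
  fix X Y g
  assume "X \<in> Obj (MF f)" "Y \<in> Obj (MF f)" and g: "g \<in> Hom (MF f) X Y"
  then show "Comp (MF f) X Y Y (Ident (MF f) Y) g = g" "Comp (MF f) X X Y g (Ident (MF f) X) = g"
    by (cases X; cases Y; auto elim!: MF_HomE)+
next
  fix W X Y Z g h k
  assume "g \<in> Hom (MF f) W X" "h \<in> Hom (MF f) X Y" "k \<in> Hom (MF f) Y Z"
  then show "Comp (MF f) W Y Z k (Comp (MF f) W X Y h g) =
      Comp (MF f) W X Z (Comp (MF f) X Y Z k h) g"
    by (auto elim!: MF_HomE)
qed

section \<open>The refined tensor product on objects and morphisms\<close>

lemma refined_tensor_simp [simp]:
  "refined_tensor (\<phi>, \<psi>) (\<sigma>, \<rho>) = (kronecker_xy \<phi> \<sigma>, kronecker_xy \<psi> \<rho>)"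
  by (simp add: refined_tensor_def)

lemma refined_tensor_mor_simp [simp]:
  "refined_tensor_mor (\<alpha>, \<beta>) (\<alpha>', \<beta>') = (kronecker_xy \<alpha> \<alpha>', kronecker_xy \<beta> \<beta>')"
  by (simp add: refined_tensor_mor_def)

lemma refined_tensor_in_matrix_factorizations:
  assumes "X \<in> matrix_factorizations f" "Y \<in> matrix_factorizations g"
  shows "refined_tensor X Y \<in> matrix_factorizations (incl_x f * incl_y g)"
proof -
  obtain n \<phi> \<psi> where X: "X = (\<phi>, \<psi>)" "\<phi> \<in> carrier_mat n n" "\<psi> \<in> carrier_mat n n"
    "\<phi> * \<psi> = f \<cdot>\<^sub>m 1\<^sub>m n" "\<psi> * \<phi> = f \<cdot>\<^sub>m 1\<^sub>m n"
    using assms(1) by (rule matrix_factorizationsE)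
  obtain m \<sigma> \<rho> where Y: "Y = (\<sigma>, \<rho>)" "\<sigma> \<in> carrier_mat m m" "\<rho> \<in> carrier_mat m m"
    "\<sigma> * \<rho> = g \<cdot>\<^sub>m 1\<^sub>m m" "\<rho> * \<sigma> = g \<cdot>\<^sub>m 1\<^sub>m m"
    using assms(2) by (rule matrix_factorizationsE)
  have "is_mf (incl_x f * incl_y g) (n * m) (refined_tensor X Y)"
    \<comment> \<open>The two instances treat the two orders of multiplication; both products become
      scalar matrices of size \<open>n * m\<close>.\<close>
    using kronecker_xy_mult[OF X(2,3) Y(2,3)] kronecker_xy_mult[OF X(3,2) Y(3,2)] X Y
    by (simp add: is_mf_def kronecker_xy_carrier kronecker_xy_smult_one)
  then show ?thesis unfolding matrix_factorizations_def by blast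
qed

text \<open>\<open>A\<close> and \<open>B\<close> may come from different positions of their pairs.
  This is harmless because the two factors of a factorization share one size: \<open>A\<close> is
  square of size \<open>n * m\<close>, and \<open>block_diag2\<close> doubles both
  dimensions.\<close>

lemma dim_mult_tensor:
  assumes "X \<in> matrix_factorizations f" "Y \<in> matrix_factorizations g"
    and "A \<in> matrix_factors (refined_tensor X Y)" "B \<in> matrix_factors (mult_tensor X Y)"
  shows "2 * dim_row A = dim_row B" "2 * dim_col A = dim_col B"
  using assms
  by (auto elim!: matrix_factorizationsE
      simp: matrix_factors_def mult_tensor_def block_diag2_def dim_kronecker_xy)

text \<open>The tensor product of two commuting squares commutes: the mixed product property turns
  each side into a Kronecker product whose factors agree by the morphism equations of
  \<open>\<zeta>\<close> and \<open>\<xi>\<close>.\<close>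

lemma refined_tensor_mor_in_Hom:
  assumes "X \<in> matrix_factorizations f" "X' \<in> matrix_factorizations f"
    and "Y \<in> matrix_factorizations g" "Y' \<in> matrix_factorizations g"
    and "\<zeta> \<in> Hom (MF f) X X'" "\<xi> \<in> Hom (MF g) Y Y'"
  shows "refined_tensor_mor \<zeta> \<xi> \<in>
    Hom (MF (incl_x f * incl_y g)) (refined_tensor X Y) (refined_tensor X' Y')"
proof -
  from assms(1-4) obtain n \<phi> \<psi> n' \<phi>' \<psi>' m \<sigma> \<rho> m' \<sigma>' \<rho>'
    where X: "X = (\<phi>, \<psi>)" "\<phi> \<in> carrier_mat n n" "\<psi> \<in> carrier_mat n n"
      and X': "X' = (\<phi>', \<psi>')" "\<phi>' \<in> carrier_mat n' n'" "\<psi>' \<in> carrier_mat n' n'"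
      and Y: "Y = (\<sigma>, \<rho>)" "\<sigma> \<in> carrier_mat m m" "\<rho> \<in> carrier_mat m m"
      and Y': "Y' = (\<sigma>', \<rho>')" "\<sigma>' \<in> carrier_mat m' m'" "\<rho>' \<in> carrier_mat m' m'"
    by (elim matrix_factorizationsE)
  obtain \<alpha> \<beta> \<gamma> \<delta> where \<zeta>: "\<zeta> = (\<alpha>, \<beta>)" and \<xi>: "\<xi> = (\<gamma>, \<delta>)" by (metis surj_pair)
  have a: "\<alpha> \<in> carrier_mat n' n" "\<beta> \<in> carrier_mat n' n" "\<alpha> * \<phi> = \<phi>' * \<beta>" "\<psi>' * \<alpha> = \<beta> * \<psi>"
    using assms(5) X X' unfolding \<zeta> by (simp_all add: MF_Hom_iff)
  have c: "\<gamma> \<in> carrier_mat m' m" "\<delta> \<in> carrier_mat m' m" "\<gamma> * \<sigma> = \<sigma>' * \<delta>" "\<rho>' * \<gamma> = \<delta> * \<rho>"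
    using assms(6) Y Y' unfolding \<xi> by (simp_all add: MF_Hom_iff)
  have "kronecker_xy \<alpha> \<gamma> * kronecker_xy \<phi> \<sigma> = kronecker_xy \<phi>' \<sigma>' * kronecker_xy \<beta> \<delta>"
    using kronecker_xy_mult[OF a(1) X(2) c(1) Y(2)] kronecker_xy_mult[OF X'(2) a(2) Y'(2) c(2)] a c
    by simp
  moreover have "kronecker_xy \<psi>' \<rho>' * kronecker_xy \<alpha> \<gamma> = kronecker_xy \<beta> \<delta> * kronecker_xy \<psi> \<rho>"
    using kronecker_xy_mult[OF X'(3) a(1) Y'(3) c(1)] kronecker_xy_mult[OF a(2) X(3) c(2) Y(3)] a c
    by simp
  ultimately show ?thesis
    using a(1,2) c(1,2) unfolding X(1) X'(1) Y(1) Y'(1) \<zeta> \<xi> refined_tensor_simp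
      refined_tensor_mor_simp
    by (subst MF_Hom_iff[OF kronecker_xy_carrier[OF X(2) Y(2)] kronecker_xy_carrier[OF X'(2) Y'(2)]])
      (simp add: kronecker_xy_carrier)
qed

lemma refined_tensor_mor_Ident:
  "refined_tensor_mor (Ident (MF f) X) (Ident (MF g) Y) =
    Ident (MF (incl_x f * incl_y g)) (refined_tensor X Y)"
  by (cases X; cases Y) (simp add: kronecker_xy_one dim_kronecker_xy)

text \<open>The interchange law is the mixed product property in each of the two components.\<close>

lemma refined_tensor_mor_Comp:
  assumes "\<zeta> \<in> Hom (MF f) X X'" "\<zeta>' \<in> Hom (MF f) X' X''"
    and "\<xi> \<in> Hom (MF g) Y Y'" "\<xi>' \<in> Hom (MF g) Y' Y''"
  shows "refined_tensor_mor (Comp (MF f) X X' X'' \<zeta>' \<zeta>) (Comp (MF g) Y Y' Y'' \<xi>' \<xi>) =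
    Comp (MF (incl_x f * incl_y g)) (refined_tensor X Y) (refined_tensor X' Y')
      (refined_tensor X'' Y'') (refined_tensor_mor \<zeta>' \<xi>') (refined_tensor_mor \<zeta> \<xi>)"
  using assms by (auto elim!: MF_HomE intro!: kronecker_xy_mult)

section \<open>The product category and the bifunctor\<close>

lemma prod_cat_simps [simp]:
  "Obj (prod_cat C D) = Obj C \<times> Obj D"
  "Hom (prod_cat C D) (X, Y) (X', Y') = Hom C X X' \<times> Hom D Y Y'"
  "Ident (prod_cat C D) (X, Y) = (Ident C X, Ident D Y)"
  "Comp (prod_cat C D) (X, Y) (X', Y') (X'', Y'') (h, h') (g, g') =
    (Comp C X X' X'' h g, Comp D Y Y' Y'' h' g')"
  by (simp_all add: prod_cat_def)

text \<open>\<open>cat_functor\<close> includes the category laws of its source, here a product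
  category; each law holds componentwise.\<close>

lemma category_prod_cat:
  assumes "category C" "category D"
  shows "category (prod_cat C D)"
proof -
  interpret C: category C by fact
  interpret D: category D by fact
  show ?thesis
  proof (unfold_locales, goal_cases)
    case (1 X)
    then show ?case by (cases X) (simp add: C.Ident_in_Hom D.Ident_in_Hom)
  next
    case (2 X Y Z g h)
    then show ?case
      by (cases X; cases Y; cases Z; cases g; cases h)
        (auto intro: C.Comp_in_Hom D.Comp_in_Hom)
  next
    case (3 X Y g)
    then show ?case
      by (cases X; cases Y; cases g) (simp add: C.Comp_Ident_left D.Comp_Ident_left)
  next
    case (4 X Y g)
    then show ?case
      by (cases X; cases Y; cases g) (simp add: C.Comp_Ident_right D.Comp_Ident_right)
  next
    case (5 W X Y Z g h k)
    then show ?case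
      by (cases W; cases X; cases Y; cases Z; cases g; cases h; cases k)
        (auto intro: C.Comp_assoc D.Comp_assoc)
  qed
qed

lemma bifunctor_refined_tensor:
  "bifunctor (MF f) (MF g) (MF (incl_x f * incl_y g))
     (\<lambda>(X, Y). refined_tensor X Y) (\<lambda>_ _ (\<zeta>\<^sub>f, \<zeta>\<^sub>g). refined_tensor_mor \<zeta>\<^sub>f \<zeta>\<^sub>g)"
proof -
  \<comment> \<open>The four goals are the actions on objects and on morphisms and the preservation
    of identities and of composites; the category laws are supplied afterwards.\<close>
  have "cat_functor_axioms (prod_cat (MF f) (MF g)) (MF (incl_x f * incl_y g))
     (\<lambda>(X, Y). refined_tensor X Y) (\<lambda>_ _ (\<zeta>\<^sub>f, \<zeta>\<^sub>g). refined_tensor_mor \<zeta>\<^sub>f \<zeta>\<^sub>g)"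
  proof (unfold_locales, goal_cases)
    case (1 P)
    then show ?case by (cases P) (simp add: refined_tensor_in_matrix_factorizations)
  next
    case (2 P Q \<zeta>)
    then show ?case by (cases P; cases Q; cases \<zeta>) (simp add: refined_tensor_mor_in_Hom)
  next
    case (3 P)
    then show ?case by (cases P) (simp only: prod_cat_simps prod.case refined_tensor_mor_Ident)
  next
    case (4 P Q R \<zeta> \<xi>)
    obtain X Y X' Y' X'' Y'' where P: "P = (X, Y)" "Q = (X', Y')" "R = (X'', Y'')"
      by (metis surj_pair)
    obtain \<zeta>\<^sub>f \<zeta>\<^sub>g \<xi>\<^sub>f \<xi>\<^sub>g where \<zeta>: "\<zeta> = (\<zeta>\<^sub>f, \<zeta>\<^sub>g)" "\<xi> = (\<xi>\<^sub>f, \<xi>\<^sub>g)" by (metis surj_pair)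
    show ?case
      using 4(4,5) unfolding P \<zeta> prod_cat_simps prod.case
      by (intro refined_tensor_mor_Comp) auto
  qed
  then show ?thesis
    unfolding bifunctor_def cat_functor_def by (simp add: category_MF category_prod_cat)
qed

theorem theoremA:
  fixes f :: "('r::finite, 'k::field) mfps" and g :: "('s::finite, 'k) mfps"
  assumes "f \<noteq> 0" and "g \<noteq> 0"
  shows "(\<forall>X \<in> matrix_factorizations f. \<forall>Y \<in> matrix_factorizations g.
            refined_tensor X Y \<in> matrix_factorizations (incl_x f * incl_y g) \<and>
            (\<forall>A \<in> matrix_factors (refined_tensor X Y). \<forall>B \<in> matrix_factors (mult_tensor X Y).
               2 * dim_row A = dim_row B \<and> 2 * dim_col A = dim_col B)) \<and>
         bifunctor (MF f) (MF g) (MF (incl_x f * incl_y g))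
           (\<lambda>(X, Y). refined_tensor X Y) (\<lambda>_ _ (\<zeta>\<^sub>f, \<zeta>\<^sub>g). refined_tensor_mor \<zeta>\<^sub>f \<zeta>\<^sub>g)"
  using refined_tensor_in_matrix_factorizations dim_mult_tensor bifunctor_refined_tensor by blast

end
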